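(* Let $x_k\in\mathbb{C}^n\setminus\{0\}$ be a given current iterate and $\rho_k=\rho(x_k)$. Consider one step of the basic Jacobi-Davidson (JD) method from $x_k$, in which the correction equation $$\Pi\,T(\rho_k)\,\Pi^*\,\Delta x_k=-T(\rho_k)x_k$$ is solved approximately by $m$ iterations of a Krylov subspace method (such as GMRES) right-preconditioned with $M_\Pi=\Pi M\Pi^*$, and the new iterate is $x_{k+1}^{\mathrm{JD}}=x_k+\Delta x_k$. Then $x_{k+1}^{\mathrm{JD}}$ lies in the search subspace from which PLMR($m$), given the same current iterate $x_k$, extracts its new iterate $x_{k+1}^{\mathrm{PLMR}}$, namely $$x_{k+1}^{\mathrm{JD}}\in\mathcal{U}_k^{\mathrm{PLMR}(m)}=\mathcal{K}_{m+1}\big(M_\Pi^{\dagger}T(\rho_k),x_k\big)+\mathrm{span}\{p_{k-1}\}.$$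
   Context: $J=(a,b)\subset\mathbb{R}$ is a finite open interval and $T(\cdot):J\to\mathbb{C}^{n\times n}$ is continuously differentiable with $T(\mu)$ Hermitian for every $\mu\in J$. The Rayleigh functional $\rho:\mathbb{C}^n\setminus\{0\}\to J$ is the continuous map sending $x$ to the unique $\rho(x)\in J$ with $x^*T(\rho(x))x=0$. $M$ is a given nonsingular matrix (a preconditioner, $M\approx T(\sigma)$ for a shift $\sigma\in J$). Define $$\Pi=I-\frac{T'(\rho_k)x_kx_k^*}{x_k^*T'(\rho_k)x_k},\qquad M_\Pi=\Pi M\Pi^*,$$ $$M_\Pi^{\dagger}b=\left(I-\frac{M^{-1}T'(\rho_k)x_k\,x_k^*T'(\rho_k)}{x_k^*T'(\rho_k)M^{-1}T'(\rho_k)x_k}\right)M^{-1}b,$$ the denominators being assumed nonzero. $\mathcal{K}_j(A,b)=\mathrm{span}\{b,Ab,\dots,A^{j-1}b\}$ denotes the Krylov subspace. The vector $p_{k-1}$ is the PLMR search direction from the previous step ($p_{-1}=0$, $p_{k-1}=x_k-x_{k-1}$ for $k\ge1$); for the lemma it may be any given vector. A Krylov subspace method right-preconditioned with $M_\Pi$ and started from a zero initial guess, applied for $m$ iterations to the correction equation, returns some $\Delta x_k\in M_\Pi^{\dagger}\,\mathcal{K}_m\big(\Pi T(\rho_k)\Pi^*M_\Pi^{\dagger},\,T(\rho_k)x_k\big)$. *)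

theory Defs
  imports "HOL-Analysis.Analysis"
begin

text \<open>Matrices and vectors are \<open>complex ^ 'n ^ 'n\<close> and \<open>complex ^ 'n\<close>. The unqualified \<open>span\<close> of
  HOL-Analysis is the real span; the complex span used here is \<open>vec.span\<close>.\<close>

definition ctranspose :: "complex^'n^'m \<Rightarrow> complex^'m^'n" where
  "ctranspose A = map_matrix cnj (transpose A)"

definition hermitian :: "complex^'n^'n \<Rightarrow> bool" where
  "hermitian A \<longleftrightarrow> ctranspose A = A"

definition cdot :: "complex^'n \<Rightarrow> complex^'n \<Rightarrow> complex" where  \<comment> \<open>\<open>x\<^sup>* y\<close>\<close>
  "cdot x y = (\<Sum>i\<in>UNIV. cnj (x $ i) * y $ i)"

definition outer :: "complex^'m \<Rightarrow> complex^'n \<Rightarrow> complex^'n^'m" where  \<comment> \<open>\<open>x y\<^sup>*\<close>\<close>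
  "outer x y = (\<chi> i j. x $ i * cnj (y $ j))"

definition rayleigh_functional ::
    "real set \<Rightarrow> (real \<Rightarrow> complex^'n^'n) \<Rightarrow> (complex^'n \<Rightarrow> real) \<Rightarrow> bool" where
  "rayleigh_functional J T \<rho> \<longleftrightarrow>
     continuous_on (UNIV - {0}) \<rho> \<and>
     (\<forall>x. x \<noteq> 0 \<longrightarrow> \<rho> x \<in> J \<and> (\<forall>\<mu>\<in>J. cdot x (T \<mu> *v x) = 0 \<longleftrightarrow> \<mu> = \<rho> x))"

definition krylov :: "nat \<Rightarrow> complex^'n^'n \<Rightarrow> complex^'n \<Rightarrow> (complex^'n) set" where
  "krylov j A b = vec.span {(((*v) A) ^^ i) b | i. i < j}"

text \<open>In the next two definitions \<open>D\<close> stands for \<open>T'(\<rho>\<^sub>k)\<close>; division by the scalar denominator is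
  entrywise.\<close>

definition jd_proj :: "complex^'n^'n \<Rightarrow> complex^'n \<Rightarrow> complex^'n^'n" where
  "jd_proj D x =
     mat 1 - map_matrix (\<lambda>z. z / cdot x (D *v x)) (outer (D *v x) x)"

text \<open>The operator \<open>M\<^sub>\<Pi>\<^sup>\<dagger>\<close> attached to the projected preconditioner \<open>M\<^sub>\<Pi> = \<Pi> M \<Pi>\<^sup>*\<close>, given by its
  explicit formula in terms of \<open>M\<close>.\<close>

definition proj_precond_pinv ::
    "complex^'n^'n \<Rightarrow> complex^'n^'n \<Rightarrow> complex^'n \<Rightarrow> complex^'n^'n" where
  "proj_precond_pinv M D x =
     (mat 1 - map_matrix (\<lambda>z. z / cdot x (D *v (matrix_inv M *v (D *v x))))
                (outer (matrix_inv M *v (D *v x)) x ** D)) ** matrix_inv M"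

text \<open>Possible results of \<open>m\<close> iterations of a Krylov subspace method, right-preconditioned with
  (generalised) inverse preconditioner \<open>P\<close> and started from zero, for a linear system with matrix \<open>A\<close>
  and right-hand side \<open>b\<close>. The set is the same for the right-hand side \<open>- b\<close>.\<close>

definition right_precond_krylov ::
    "nat \<Rightarrow> complex^'n^'n \<Rightarrow> complex^'n^'n \<Rightarrow> complex^'n \<Rightarrow> (complex^'n) set" where
  "right_precond_krylov m A P b = (*v) P ` krylov m (A ** P) b"

text \<open>In the next two definitions \<open>A\<close> stands for \<open>T(\<rho>\<^sub>k)\<close> and \<open>D\<close> for \<open>T'(\<rho>\<^sub>k)\<close>.\<close>

text \<open>Approximate solutions of the correction equation \<open>\<Pi> A \<Pi>\<^sup>* \<Delta>x = - A x\<close>.\<close>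

definition jd_corrections ::
    "nat \<Rightarrow> complex^'n^'n \<Rightarrow> complex^'n^'n \<Rightarrow> complex^'n^'n \<Rightarrow> complex^'n \<Rightarrow> (complex^'n) set" where
  "jd_corrections m M A D x =
     right_precond_krylov m (jd_proj D x ** A ** ctranspose (jd_proj D x))
       (proj_precond_pinv M D x) (A *v x)"

definition plmr_search_space ::
    "nat \<Rightarrow> complex^'n^'n \<Rightarrow> complex^'n^'n \<Rightarrow> complex^'n^'n \<Rightarrow> complex^'n \<Rightarrow> complex^'n
     \<Rightarrow> (complex^'n) set" where
  "plmr_search_space m M A D x p =
     {u + v | u v. u \<in> krylov (m + 1) (proj_precond_pinv M D x ** A) x \<and> v \<in> vec.span {p}}"

end

theory Submission
  imports Defs
begin

text \<open>Write \<open>P = M\<^sub>\<Pi>\<^sup>\<dagger>\<close>, \<open>A = T(\<rho>\<^sub>k)\<close> and \<open>D = T'(\<rho>\<^sub>k)\<close>; the matrix \<open>D\<close> is Hermitian as a derivative of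
  Hermitian matrices. The explicit formula for \<open>P\<close> gives \<open>P D x = 0\<close> and \<open>x\<^sup>* D P = 0\<close>, that is,
  \<open>P \<Pi> = P\<close> and \<open>\<Pi>\<^sup>* P = P\<close>. Hence \<open>P (\<Pi> A \<Pi>\<^sup>* P)\<^sup>i A x = (P A)\<^sup>i\<^sup>+\<^sup>1 x\<close>, so the correction \<open>\<Delta>x\<close> lies in
  the Krylov space of \<open>P A\<close> and \<open>x\<close> of order \<open>m + 1\<close>, and so does \<open>x\<close> itself.\<close>

lemma cdot_scale_right: "cdot u (c *s v) = c * cdot u v"
  by (simp add: cdot_def sum_distrib_left mult_ac)

lemma cdot_diff_right: "cdot u (v - w) = cdot u v - cdot u w"
  by (simp add: cdot_def right_diff_distrib sum_subtractf)

lemma cnj_cdot: "cnj (cdot u v) = cdot v u"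
  by (simp add: cdot_def mult.commute)

lemma cdot_ctranspose: "cdot (ctranspose A *v u) v = cdot u (A *v v)"
proof -
  have "cdot (ctranspose A *v u) v = (\<Sum>i\<in>UNIV. \<Sum>j\<in>UNIV. cnj (u $ j) * (A $ j $ i * v $ i))"
    by (simp add: cdot_def ctranspose_def matrix_vector_mult_def transpose_def map_matrix_def
        sum_distrib_left sum_distrib_right mult_ac)
  also have "\<dots> = cdot u (A *v v)"
    by (subst sum.swap) (simp add: cdot_def matrix_vector_mult_def sum_distrib_left)
  finally show ?thesis .
qed

lemma cdot_hermitian: "hermitian A \<Longrightarrow> cdot (A *v u) v = cdot u (A *v v)"
  by (metis cdot_ctranspose hermitian_def)

lemma outer_mult_vec: "outer u v *v z = cdot v z *s u"
  by (simp add: outer_def cdot_def matrix_vector_mult_def vec_eq_iff sum_distrib_left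
      sum_distrib_right mult_ac)

lemma map_matrix_divide_mult_vec:
  fixes A :: "complex^'n^'m"
  shows "map_matrix (\<lambda>z. z / c) A *v z = (1 / c) *s (A *v z)"
  by (simp add: map_matrix_def matrix_vector_mult_def vec_eq_iff sum_divide_distrib)

lemma ctranspose_minus_outer:
  "ctranspose (mat 1 - map_matrix (\<lambda>z. z / c) (outer u v))
     = mat 1 - map_matrix (\<lambda>z. z / cnj c) (outer v u)"
  by (simp add: ctranspose_def map_matrix_def transpose_def outer_def mat_def vec_eq_iff mult.commute)

lemma jd_proj_mult_vec:
  "jd_proj D x *v z = z - (cdot x z / cdot x (D *v x)) *s (D *v x)"
  by (simp add: jd_proj_def matrix_vector_mult_diff_rdistrib map_matrix_divide_mult_vec outer_mult_vec)

text \<open>As \<open>D\<close> is Hermitian, it moves across \<open>cdot\<close>, and the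
  denominator is real, hence unchanged by the conjugation.\<close>

lemma ctranspose_jd_proj_mult_vec:
  assumes "hermitian D"
  shows "ctranspose (jd_proj D x) *v z = z - (cdot x (D *v z) / cdot x (D *v x)) *s x"
  using assms
  by (simp add: jd_proj_def ctranspose_minus_outer matrix_vector_mult_diff_rdistrib
      map_matrix_divide_mult_vec outer_mult_vec cnj_cdot cdot_hermitian)

lemma proj_precond_pinv_mult_vec:
  fixes D M :: "complex^'n^'n"
  defines "w x \<equiv> matrix_inv M *v (D *v x)"
  shows "proj_precond_pinv M D x *v z = matrix_inv M *v z
      - (cdot x (D *v (matrix_inv M *v z)) / cdot x (D *v w x)) *s w x"
  by (simp add: proj_precond_pinv_def w_def matrix_vector_mult_diff_rdistrib
      matrix_vector_mul_assoc[symmetric] map_matrix_divide_mult_vec outer_mult_vec)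

text \<open>\<open>jd_proj D x\<close> changes \<open>z\<close> only by a multiple of
  \<open>D *v x\<close>, which the preconditioner annihilates.\<close>

lemma proj_precond_pinv_jd_proj:
  assumes "cdot x (D *v (matrix_inv M *v (D *v x))) \<noteq> 0"
  shows "proj_precond_pinv M D x *v (jd_proj D x *v z) = proj_precond_pinv M D x *v z"
proof -
  have "proj_precond_pinv M D x *v (D *v x) = 0"
    using assms by (simp add: proj_precond_pinv_mult_vec)
  then show ?thesis
    by (simp add: jd_proj_mult_vec matrix_vector_mult_diff_distrib vector_scalar_commute)
qed

text \<open>The subtracted multiple of \<open>x\<close> vanishes: its coefficient contains
  \<open>cdot x (D *v y)\<close>, which is 0 for every \<open>y\<close> in the range of the
  preconditioner.\<close>

lemma ctranspose_jd_proj_proj_precond_pinv: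
  assumes "hermitian D" "cdot x (D *v (matrix_inv M *v (D *v x))) \<noteq> 0"
  shows "ctranspose (jd_proj D x) *v (proj_precond_pinv M D x *v z) = proj_precond_pinv M D x *v z"
proof -
  have "cdot x (D *v (proj_precond_pinv M D x *v z)) = 0"
    using assms(2)
    by (simp add: proj_precond_pinv_mult_vec matrix_vector_mult_diff_distrib
        vector_scalar_commute cdot_diff_right cdot_scale_right)
  then show ?thesis
    by (simp add: ctranspose_jd_proj_mult_vec[OF assms(1)])
qed

lemma funpow_mem_krylov: "i < j \<Longrightarrow> (((*v) A) ^^ i) b \<in> krylov j A b"
  unfolding krylov_def by (rule vec.span_base) blast

text \<open>Agreement of \<open>A\<close> and \<open>B\<close> between two factors \<open>P\<close>
  suffices: the starting vector is already \<open>B *v x\<close>, so each \<open>A\<close> has a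
  \<open>P\<close> on both sides.\<close>

lemma right_precond_krylov_subset_krylov:
  assumes "\<And>z. P *v (A *v (P *v z)) = P *v (B *v (P *v z))"
  shows "right_precond_krylov m A P (B *v x) \<subseteq> krylov (m + 1) (P ** B) x"
proof -
  let ?K = "krylov (m + 1) (P ** B) x"
  \<comment> \<open>The outer \<open>P\<close> and the \<open>B\<close> of the starting vector
    supply one more factor \<open>P ** B\<close>, which raises the order from \<open>m\<close> to
    \<open>m + 1\<close>.\<close>
  have pow: "P *v (((*v) (A ** P)) ^^ i) (B *v x) = (((*v) (P ** B)) ^^ Suc i) x" for i
    by (induction i) (simp_all add: assms matrix_vector_mul_assoc[symmetric])
  have "P *v y \<in> ?K" if "y \<in> krylov m (A ** P) (B *v x)" for y
    using that[unfolded krylov_def]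
  proof (induction rule: vec.span_induct)
    \<comment> \<open>The vectors that \<open>P\<close> maps into \<open>?K\<close> form a subspace,
      being a preimage under a linear map.\<close>
    case base
    show ?case
      unfolding vec.subspace_def
      by (simp add: krylov_def matrix_vector_right_distrib vector_scalar_commute vec.span_zero
          vec.span_add vec.span_scale)
  next
    case (step y)
    then show ?case
      using funpow_mem_krylov[of "Suc i" "m + 1" for i] by (fastforce simp: pow simp del: funpow.simps)
  qed
  then show ?thesis
    by (auto simp: right_precond_krylov_def)
qed

lemma jd_corrections_subset_krylov:
  assumes "hermitian D" "cdot x (D *v (matrix_inv M *v (D *v x))) \<noteq> 0"
  shows "jd_corrections m M A D x \<subseteq> krylov (m + 1) (proj_precond_pinv M D x ** A) x"
  unfolding jd_corrections_def
  by (rule right_precond_krylov_subset_krylov)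
    (simp add: matrix_vector_mul_assoc[symmetric] proj_precond_pinv_jd_proj[OF assms(2)]
      ctranspose_jd_proj_proj_precond_pinv[OF assms])

text \<open>Conjugation is real-linear, which is what differentiation in a real parameter
  requires.\<close>

lemma bounded_linear_ctranspose: "bounded_linear ctranspose"
  unfolding linear_conv_bounded_linear[symmetric]
  by (rule linearI)
    (simp_all add: ctranspose_def map_matrix_def transpose_def vec_eq_iff complex_cnj_scaleR)

text \<open>Near \<open>\<mu>\<close> the function equals its own conjugate transpose, so uniqueness
  of the derivative gives the claim.\<close>

lemma hermitian_derivative:
  assumes "open S" "\<mu> \<in> S" "(T has_vector_derivative D) (at \<mu>)"
    and "\<And>\<nu>. \<nu> \<in> S \<Longrightarrow> hermitian (T \<nu>)"
  shows "hermitian D"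
proof -
  have "((\<lambda>\<nu>. ctranspose (T \<nu>)) has_vector_derivative ctranspose D) (at \<mu>)"
    by (rule bounded_linear.has_vector_derivative[OF bounded_linear_ctranspose assms(3)])
  then have "(T has_vector_derivative ctranspose D) (at \<mu>)"
    by (rule has_vector_derivative_transform_within_open[OF _ assms(1,2)])
      (use assms(4) in \<open>simp add: hermitian_def\<close>)
  then show ?thesis
    using assms(3) vector_derivative_unique_at unfolding hermitian_def by blast
qed

theorem lemma4p1:
  fixes a b :: real
    and T T' :: "real \<Rightarrow> complex^'n^'n"
    and \<rho> :: "complex^'n \<Rightarrow> real"
    and M :: "complex^'n^'n"
    and x p \<Delta>x :: "complex^'n"
    and m :: nat
  assumes "a < b"
    and "\<And>\<mu>. \<mu> \<in> {a<..<b} \<Longrightarrow> (T has_vector_derivative T' \<mu>) (at \<mu>)"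
    and "continuous_on {a<..<b} T'"
    and "\<And>\<mu>. \<mu> \<in> {a<..<b} \<Longrightarrow> hermitian (T \<mu>)"
    and "rayleigh_functional {a<..<b} T \<rho>"
    and "invertible M"
    and "x \<noteq> 0"
    and "cdot x (T' (\<rho> x) *v x) \<noteq> 0"
    and "cdot x (T' (\<rho> x) *v (matrix_inv M *v (T' (\<rho> x) *v x))) \<noteq> 0"
    and "\<Delta>x \<in> jd_corrections m M (T (\<rho> x)) (T' (\<rho> x)) x"
  shows "x + \<Delta>x \<in> plmr_search_space m M (T (\<rho> x)) (T' (\<rho> x)) x p"
proof -
  have \<rho>: "\<rho> x \<in> {a<..<b}"
    using assms(5,7) by (auto simp: rayleigh_functional_def)
  have D: "hermitian (T' (\<rho> x))"
    by (rule hermitian_derivative[OF _ \<rho> assms(2)[OF \<rho>] assms(4)]) simp_all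
  let ?P = "proj_precond_pinv M (T' (\<rho> x)) x"
  let ?K = "krylov (m + 1) (?P ** T (\<rho> x)) x"
  have "\<Delta>x \<in> ?K"
    using jd_corrections_subset_krylov[OF D assms(9)] assms(10) by blast
  \<comment> \<open>\<open>x\<close> is the generator with exponent 0, present even for
    \<open>m = 0\<close>.\<close>
  moreover have "x \<in> ?K"
    using funpow_mem_krylov[of 0 "m + 1"] by simp
  ultimately have "x + \<Delta>x \<in> ?K"
    unfolding krylov_def by (rule vec.span_add[rotated])
  \<comment> \<open>The component in the span of \<open>p\<close> is chosen as 0.\<close>
  then show ?thesis
    unfolding plmr_search_space_def
    by (intro CollectI exI[of _ "x + \<Delta>x"] exI[of _ 0]) (simp add: vec.span_zero)
qed

end
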